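(* Let $a_1<a_2<\dots<a_n$ be real numbers and $w_1,\dots,w_n\in\mathbb{C}$, and let $\gamma:\mathbb{R}\to\mathbb{C}$, $\gamma(t)=\sum_{j=1}^n w_j e^{2\pi i a_j t}$. If $a_1,\dots,a_n,1$ are linearly independent over $\mathbb{Q}$, then the image $\gamma(\mathbb{R})$ is dense in an annulus of the complex plane, i.e. there are real numbers $0\le r\le R$ such that $\gamma(\mathbb{R})$ is a dense subset of $\{z\in\mathbb{C}: r\le |z|\le R\}$. *)

theory Defs
  imports "HOL-Analysis.Analysis"
begin

text \<open>
  Linear independence over the rationals of a finite family of reals, given as a list.
  The library predicate \<open>module.independent\<close> is about sets and so ignores repetitions;
  a family with a repeated entry is linearly dependent, whence the distinctness condition.
\<close>

definition rat_lin_indep :: "real list \<Rightarrow> bool" where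
  "rat_lin_indep xs \<longleftrightarrow>
     distinct xs \<and> module.independent (\<lambda>q::rat. (*) (of_rat q :: real)) (set xs)"

end

theory Submission
  imports Defs
begin

text \<open>
  By Kronecker's theorem the curve \<open>\<gamma>\<close> is dense in the set \<open>K\<close> of all sums
  \<open>\<Sum>j. w j * cis (x j)\<close> with independent phases \<open>x j\<close>, and it lies in \<open>K\<close>. The set \<open>K\<close> is
  invariant under rotation, and its moduli form an interval because any two phase vectors are
  joined by a segment; hence \<open>K\<close> is dense in the annulus bounded by the infimum and supremum
  of these moduli.
\<close>

text \<open>A chord is at most as long as its arc: rotating \<open>y\<close> to 0 leaves
  \<open>exp (\<i> * s) - 1\<close> with \<open>s = x - y\<close>, whose modulus is
  \<open>2 * \<bar>sin (s / 2)\<bar>\<close>.\<close>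

lemma norm_cis_diff_le: "cmod (cis x - cis y) \<le> \<bar>x - y\<bar>"
proof -
  have "cis x - cis y = cis y * (cis (x - y) - 1)"
    by (simp add: right_diff_distrib cis_mult)
  then have "cmod (cis x - cis y) = cmod (exp (\<i> * of_real (x - y)) - 1)"
    by (simp only: norm_mult norm_cis cis_conv_exp) simp
  also have "\<dots> = 2 * \<bar>sin ((x - y) / 2)\<bar>"
    by (rule dist_exp_i_1)
  also have "\<dots> \<le> \<bar>x - y\<bar>"
    using abs_sin_x_le_abs_x[of "(x - y) / 2"] by simp
  finally show ?thesis .
qed

lemma cis_2pi_diff_int: "cis (2 * pi * (x - of_int m)) = cis (2 * pi * x)"
  by (simp add: right_diff_distrib flip: cis_divide)

text \<open>Integer coefficients are rational ones. This supplies \<open>Kronecker_thm_1\<close>,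
  which asks for independence over the integers.\<close>

lemma independent_int_of_rat:
  assumes "module.independent (\<lambda>q::rat. (*) (of_rat q :: real)) S"
  shows "module.independent (\<lambda>r. (*) (real_of_int r)) S"
proof -
  interpret Q: Modules.module "\<lambda>q::rat. (*) (of_rat q :: real)"
    by standard (simp_all add: algebra_simps of_rat_add of_rat_mult)
  interpret Z: Modules.module "\<lambda>r. (*) (real_of_int r)"
    by standard (simp_all add: algebra_simps)
  show ?thesis
    unfolding Z.independent_explicit_module
  proof (intro allI impI)
    fix T u v
    assume T: "finite T" "T \<subseteq> S" "(\<Sum>v\<in>T. real_of_int (u v) * v) = 0" "v \<in> T"
    have "rat_of_int (u v) = 0"
      using Q.independentD[OF assms T(1,2), of "\<lambda>v. of_int (u v)" v] T(3,4) by simp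
    then show "u v = 0" by simp
  qed
qed

text \<open>The set \<open>K\<close> of the overview. Phases are real numbers, not points of a
  torus, so that segments between phase vectors make sense.\<close>

definition phase_sums :: "nat \<Rightarrow> (nat \<Rightarrow> complex) \<Rightarrow> complex set" where
  "phase_sums n w = range (\<lambda>x. \<Sum>j=1..n. w j * cis (x j))"

lemma phase_sums_rotate:
  assumes "z \<in> phase_sums n w"
  shows "cis \<theta> * z \<in> phase_sums n w"
proof -
  obtain x where "z = (\<Sum>j=1..n. w j * cis (x j))"
    using assms by (auto simp: phase_sums_def)
  then have "cis \<theta> * z = (\<Sum>j=1..n. w j * cis (\<theta> + x j))"
    by (simp add: sum_distrib_left mult_ac flip: cis_mult)
  then show ?thesis
    by (auto simp: phase_sums_def)
qed

lemma norm_phase_sums_le: "z \<in> phase_sums n w \<Longrightarrow> cmod z \<le> (\<Sum>j=1..n. cmod (w j))"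
  by (auto simp: phase_sums_def norm_mult intro!: sum_norm_le)

lemma is_interval_norm_phase_sums: "is_interval (cmod ` phase_sums n w)"
  unfolding is_interval_1
proof (intro ballI allI impI)
  fix p q s
  assume p: "p \<in> cmod ` phase_sums n w" and q: "q \<in> cmod ` phase_sums n w" and s: "p \<le> s \<and> s \<le> q"
  obtain x y where x: "p = cmod (\<Sum>j=1..n. w j * cis (x j))" and y: "q = cmod (\<Sum>j=1..n. w j * cis (y j))"
    using p q by (auto simp: phase_sums_def)
  define f where "f = (\<lambda>u::real. cmod (\<Sum>j=1..n. w j * cis ((1 - u) * x j + u * y j)))"
  have "continuous_on {0..1} f"
    unfolding f_def by (intro continuous_intros)
  then obtain u where "f u = s"
    using IVT'[of f 0 s 1] s x y by (auto simp: f_def)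
  then show "s \<in> cmod ` phase_sums n w"
    by (auto simp: f_def phase_sums_def)
qed

text \<open>Some modulus in \<open>S\<close> is within \<open>e\<close> of \<open>cmod z\<close>,
  and a rotation brings the point having it onto the ray of \<open>z\<close>. Working up to
  \<open>e\<close> avoids proving that the infimum and supremum are attained.\<close>

lemma annulus_subset_closure_phase_sums:
  fixes n w
  defines "S \<equiv> cmod ` phase_sums n w"
  assumes z: "Inf S \<le> cmod z" "cmod z \<le> Sup S"
  shows "z \<in> closure (phase_sums n w)"
  unfolding closure_approachable
proof (intro allI impI)
  fix e :: real
  assume e: "e > 0"
  have ne: "S \<noteq> {}"
    by (simp add: S_def phase_sums_def)
  obtain p where p: "p \<in> S" "p < cmod z + e"
    using cInf_lessD[OF ne, of "cmod z + e"] z e by auto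
  obtain q where q: "q \<in> S" "q > cmod z - e"
    using less_cSupD[OF ne, of "cmod z - e"] z e by auto
  have S: "is_interval S"
    unfolding S_def by (rule is_interval_norm_phase_sums)
  \<comment> \<open>Either \<open>p\<close> or \<open>q\<close> is itself close enough, or
    \<open>p < cmod z < q\<close> and the interval property applies.\<close>
  have "\<exists>s\<in>S. \<bar>s - cmod z\<bar> < e"
  proof (cases "p > cmod z - e \<or> q < cmod z + e")
    case True
    with p q show ?thesis
      by (metis abs_diff_less_iff)
  next
    case False
    with e p q have "cmod z \<in> S"
      by (intro mem_is_interval_1_I[OF S p(1) q(1)]) auto
    with e show ?thesis by force
  qed
  then obtain k where k: "k \<in> phase_sums n w" "\<bar>cmod k - cmod z\<bar> < e"
    by (auto simp: S_def)
  \<comment> \<open>After this rotation the distance to \<open>z\<close> is just the difference of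
    the moduli.\<close>
  have k': "cis (Arg z - Arg k) * k = of_real (cmod k) * cis (Arg z)"
    by (subst (2) rcis_cmod_Arg[of k, symmetric]) (simp add: rcis_def cis_mult)
  have "cmod (of_real (cmod k) * cis (Arg z) - z) = cmod (of_real (cmod k - cmod z) * cis (Arg z))"
    by (subst (2) rcis_cmod_Arg[of z, symmetric]) (simp add: rcis_def algebra_simps)
  also have "\<dots> < e"
    using k(2) by (simp add: norm_mult del: of_real_diff)
  finally show "\<exists>y\<in>phase_sums n w. dist y z < e"
    using phase_sums_rotate[OF k(1), of "Arg z - Arg k"] unfolding k' dist_norm by blast
qed

lemma phase_sums_subset_closure:
  fixes a :: "nat \<Rightarrow> real"
  assumes inj: "inj_on a {1..n}"
    and indep: "module.independent (\<lambda>q::rat. (*) (of_rat q :: real)) (a ` {1..n})"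
  shows "phase_sums n w \<subseteq> closure (range (\<lambda>t. \<Sum>j=1..n. w j * cis (2 * pi * (t * a j))))"
proof
  fix z assume "z \<in> phase_sums n w"
  then obtain x where z: "z = (\<Sum>j=1..n. w j * cis (x j))"
    by (auto simp: phase_sums_def)
  show "z \<in> closure (range (\<lambda>t. \<Sum>j=1..n. w j * cis (2 * pi * (t * a j))))"
    unfolding closure_approachable
  proof (intro allI impI)
    fix e :: real
    assume e: "e > 0"
    \<comment> \<open>The summand 1 keeps \<open>W\<close> positive when all weights vanish and
      makes the final estimate strict; \<open>d\<close> is chosen so that
      \<open>W * (2 * pi * d) = e\<close>.\<close>
    define W where "W = 1 + (\<Sum>j=1..n. cmod (w j))"
    have W: "W > 0"
      by (auto simp: W_def intro!: add_pos_nonneg sum_nonneg)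
    define d where "d = e / (2 * pi * W)"
    have d: "d > 0"
      using e W by (simp add: d_def)
    \<comment> \<open>Kronecker's theorem indexes the family by \<open>{..<n}\<close>, the sums here
      by \<open>{1..n}\<close>.\<close>
    have im: "(\<lambda>i. a (Suc i)) ` {..<n} = a ` {1..n}"
      by (simp only: image_Suc_lessThan flip: image_image[of a Suc])
    have "inj_on (\<lambda>i. a (Suc i)) {..<n}"
      using comp_inj_on[of Suc "{..<n}" a] inj by (simp add: image_Suc_lessThan o_def)
    then obtain t h where th:
      "\<And>i. i < n \<Longrightarrow> \<bar>t * a (Suc i) - of_int (h i) - x (Suc i) / (2 * pi)\<bar> < d"
      using Kronecker_thm_1[of "\<lambda>i. a (Suc i)" n d "\<lambda>i. x (Suc i) / (2 * pi)"]
        independent_int_of_rat[OF indep] d unfolding im by blast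
    have cis_le: "cmod (cis (2 * pi * (t * a j)) - cis (x j)) \<le> 2 * pi * d" if j: "j \<in> {1..n}" for j
    proof -
      obtain i where i: "j = Suc i" "i < n"
        using j by (cases j) auto
      \<comment> \<open>Kronecker's theorem approximates only modulo 1; the integer
        \<open>h i\<close> turns the phase by full circles and so can be inserted freely.\<close>
      have "cmod (cis (2 * pi * (t * a j)) - cis (x j))
          = cmod (cis (2 * pi * (t * a j - of_int (h i))) - cis (x j))"
        by (simp only: cis_2pi_diff_int)
      also have "\<dots> \<le> \<bar>2 * pi * (t * a j - of_int (h i)) - x j\<bar>"
        by (rule norm_cis_diff_le)
      also have "\<dots> = \<bar>2 * pi * (t * a j - of_int (h i) - x j / (2 * pi))\<bar>"
        by (simp add: right_diff_distrib)
      also have "\<dots> = 2 * pi * \<bar>t * a j - of_int (h i) - x j / (2 * pi)\<bar>"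
        by (simp only: abs_mult) simp
      also have "\<dots> \<le> 2 * pi * d"
        using th[OF i(2)] i(1) by (intro mult_left_mono) auto
      finally show ?thesis .
    qed
    have "cmod ((\<Sum>j=1..n. w j * cis (2 * pi * (t * a j))) - z)
        = cmod (\<Sum>j=1..n. w j * (cis (2 * pi * (t * a j)) - cis (x j)))"
      by (simp add: z right_diff_distrib sum_subtractf)
    also have "\<dots> \<le> (\<Sum>j=1..n. cmod (w j) * (2 * pi * d))"
      by (intro sum_norm_le) (auto simp: norm_mult intro!: mult_left_mono cis_le)
    also have "\<dots> = (W - 1) * (2 * pi * d)"
      by (simp add: W_def sum_distrib_right)
    also have "\<dots> < W * (2 * pi * d)"
      using d by simp
    also have "\<dots> = e"
      using W by (simp add: d_def)
    finally show "\<exists>y\<in>range (\<lambda>t. \<Sum>j=1..n. w j * cis (2 * pi * (t * a j))). dist y z < e"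
      unfolding dist_norm by blast
  qed
qed

theorem theorem3:
  fixes n :: nat and a :: "nat \<Rightarrow> real" and w :: "nat \<Rightarrow> complex"
    and \<gamma> :: "real \<Rightarrow> complex"
  assumes a_less: "strict_mono_on {1..n} a"
    and \<gamma>_eq: "\<And>t. \<gamma> t =
      (\<Sum>j=1..n. w j * exp (2 * complex_of_real pi * \<i> * complex_of_real (a j) * complex_of_real t))"
    and indep: "rat_lin_indep (map a [1..<n + 1] @ [1])"
  shows "\<exists>r R :: real. 0 \<le> r \<and> r \<le> R \<and>
    range \<gamma> \<subseteq> {z. r \<le> cmod z \<and> cmod z \<le> R} \<and>
    {z. r \<le> cmod z \<and> cmod z \<le> R} \<subseteq> closure (range \<gamma>)"
proof -
  interpret Q: Modules.module "\<lambda>q::rat. (*) (of_rat q :: real)"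
    by standard (simp_all add: algebra_simps of_rat_add of_rat_mult)
  have \<gamma>: "\<gamma> = (\<lambda>t. \<Sum>j=1..n. w j * cis (2 * pi * (t * a j)))"
    by (rule ext) (simp add: \<gamma>_eq cis_conv_exp mult_ac)
  have "a ` {1..n} \<subseteq> set (map a [1..<n + 1] @ [1])"
    by auto
  then have "Q.independent (a ` {1..n})"
    using indep Q.independent_mono unfolding rat_lin_indep_def by blast
  then have dense: "phase_sums n w \<subseteq> closure (range \<gamma>)"
    unfolding \<gamma> using strict_mono_on_imp_inj_on[OF a_less] by (rule phase_sums_subset_closure[rotated])
  have sub: "range \<gamma> \<subseteq> phase_sums n w"
    by (auto simp: \<gamma> phase_sums_def)
  \<comment> \<open>The radii are \<open>Inf S\<close> and \<open>Sup S\<close>; they are genuine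
    bounds because \<open>S\<close> is nonempty and bounded.\<close>
  define S where "S = cmod ` phase_sums n w"
  have bdd: "bdd_above S" "bdd_below S"
    using norm_phase_sums_le by (auto simp: S_def intro!: bdd_aboveI2 bdd_belowI2[of _ 0])
  have ne: "S \<noteq> {}"
    by (simp add: S_def phase_sums_def)
  have "0 \<le> Inf S"
    using ne by (intro cInf_greatest) (auto simp: S_def)
  moreover have "Inf S \<le> Sup S"
    using ne bdd by (intro cInf_le_cSup)
  moreover have "range \<gamma> \<subseteq> {z. Inf S \<le> cmod z \<and> cmod z \<le> Sup S}"
    using sub bdd by (auto simp: S_def intro!: cInf_lower cSup_upper)
  \<comment> \<open>The annulus lies in the closure of \<open>phase_sums n w\<close>, which lies in
    the closed set \<open>closure (range \<gamma>)\<close> by \<open>dense\<close>.\<close>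
  moreover have "{z. Inf S \<le> cmod z \<and> cmod z \<le> Sup S} \<subseteq> closure (range \<gamma>)"
    using annulus_subset_closure_phase_sums closure_minimal[OF dense closed_closure]
    unfolding S_def by blast
  ultimately show ?thesis by blast
qed

end
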